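(* Let $m\ge 2$ and $n\ge r+1\ge 2$ be integers. If ($3\le m\le 4$ and $2\le r\le 3$), or if $(m-1)(r-1)\le\binom{r+1}{2}$, then $\chi_{la}(A(mK_n,K_r)\vee K_1)=n+1$.
   Context: Graphs are finite and simple. For $m\ge 2$ and $n>r\ge 1$, $A(mK_n,K_r)$ is the amalgamation of $m$ copies of $K_n$ along $K_r$: it has vertices $v_{i,j}$ ($1\le i\le m$, $1\le j\le n$) where $v_{1,j}=\cdots=v_{m,j}$ for each $1\le j\le r$ (and no other identifications), and edges $v_{i,j}v_{i,k}$ for $1\le i\le m$, $1\le j<k\le n$. $G\vee K_1$ is obtained from $G$ by adding one new vertex adjacent to every vertex of $G$. A local antimagic labeling of a graph $H$ of size $q$ is a bijection $g:E(H)\to\{1,\ldots,q\}$ such that $g^+(u)\ne g^+(v)$ for every edge $uv$ of $H$, where $g^+(u)=\sum_{ux\in E(H)}g(ux)$; $\chi_{la}(H)$ is the minimum number of distinct values of $g^+$ over all local antimagic labelings $g$ of $H$. *)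

theory Defs
  imports Complex_Main
begin

type_synonym 'a graph = "'a set \<times> 'a set set"

definition verts :: "'a graph \<Rightarrow> 'a set" where
  "verts G = fst G"

definition edges :: "'a graph \<Rightarrow> 'a set set" where
  "edges G = snd G"

definition simple_graph :: "'a graph \<Rightarrow> bool" where
  "simple_graph G \<longleftrightarrow> finite (verts G) \<and> (\<forall>e\<in>edges G. e \<subseteq> verts G \<and> card e = 2)"

text \<open>
  The vertex \<open>v\<^sub>i\<^sub>,\<^sub>j\<close> of the amalgamation of copies of \<open>K\<^sub>n\<close> along \<open>K\<^sub>r\<close>. For \<open>j \<le> r\<close> it does not
  depend on the copy \<open>i\<close>; this realises the identification, and no other vertices coincide.
\<close>
definition amalg_vertex :: "nat \<Rightarrow> nat \<Rightarrow> nat \<Rightarrow> nat \<times> nat" where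
  "amalg_vertex r i j = (if j \<le> r then (1, j) else (i, j))"

definition amalg_complete :: "nat \<Rightarrow> nat \<Rightarrow> nat \<Rightarrow> (nat \<times> nat) graph" where
  "amalg_complete m n r =
     ({amalg_vertex r i j | i j. 1 \<le> i \<and> i \<le> m \<and> 1 \<le> j \<and> j \<le> n},
      {{amalg_vertex r i j, amalg_vertex r i k} | i j k.
         1 \<le> i \<and> i \<le> m \<and> 1 \<le> j \<and> j < k \<and> k \<le> n})"

text \<open>The join \<open>G \<or> K\<^sub>1\<close>; the new vertex is \<^term>\<open>None\<close>.\<close>
definition join_K1 :: "'a graph \<Rightarrow> 'a option graph" where
  "join_K1 G =
     (insert None (Some ` verts G),
      (\<lambda>e. Some ` e) ` edges G \<union> {{None, Some v} | v. v \<in> verts G})"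

definition induced_label :: "'a graph \<Rightarrow> ('a set \<Rightarrow> nat) \<Rightarrow> 'a \<Rightarrow> nat" where
  "induced_label H g u = (\<Sum>x | {u, x} \<in> edges H. g {u, x})"

definition local_antimagic :: "'a graph \<Rightarrow> ('a set \<Rightarrow> nat) \<Rightarrow> bool" where
  "local_antimagic H g \<longleftrightarrow>
     bij_betw g (edges H) {1..card (edges H)} \<and>
     (\<forall>u v. {u, v} \<in> edges H \<longrightarrow> induced_label H g u \<noteq> induced_label H g v)"

text \<open>
  On \<^typ>\<open>nat\<close>, the infimum of a nonempty set is its minimum, and the infimum of the empty set
  is \<open>0\<close>. So a positive value says in particular that a local antimagic labeling exists.
\<close>
definition chi_la :: "'a graph \<Rightarrow> nat" where
  "chi_la H = Inf {card (induced_label H g ` verts H) | g. local_antimagic H g}"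

lemma amalg_vertex_eq_iff:
  assumes "1 \<le> i" "1 \<le> i'"
  shows "amalg_vertex r i j = amalg_vertex r i' j' \<longleftrightarrow> j = j' \<and> (j \<le> r \<or> i = i')"
  using assms by (auto simp: amalg_vertex_def)

lemma simple_graph_amalg_complete: "simple_graph (amalg_complete m n r)"
proof -
  let ?V = "{amalg_vertex r i j | i j. 1 \<le> i \<and> i \<le> m \<and> 1 \<le> j \<and> j \<le> n}"
  have "?V \<subseteq> (\<Union>i\<in>{1..m}. \<Union>j\<in>{1..n}. {amalg_vertex r i j})"
    by fastforce
  then have "finite ?V"
    by (rule finite_subset) simp
  moreover have "e \<subseteq> ?V \<and> card e = 2" if "e \<in> edges (amalg_complete m n r)" for e
  proof -
    from that obtain i j k where *: "1 \<le> i" "i \<le> m" "1 \<le> j" "j < k" "k \<le> n"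
      and e: "e = {amalg_vertex r i j, amalg_vertex r i k}"
      by (auto simp: edges_def amalg_complete_def)
    from * have "amalg_vertex r i j \<noteq> amalg_vertex r i k"
      by (simp add: amalg_vertex_eq_iff)
    moreover from * have "j \<le> n" "1 \<le> k" by simp_all
    with * have "e \<subseteq> ?V" unfolding e by blast
    ultimately show ?thesis by (simp add: e)
  qed
  ultimately show ?thesis
    by (simp add: simple_graph_def verts_def amalg_complete_def)
qed

lemma simple_graph_join_K1:
  assumes "simple_graph G"
  shows "simple_graph (join_K1 G)"
  using assms by (fastforce simp: simple_graph_def join_K1_def verts_def edges_def card_image)

end

theory Submission
  imports Defs
begin

text \<open>
  Adding a vertex that is joined to everything turns the amalgamation of \<open>m\<close> copies of \<open>K\<^sub>n\<close> along
  \<open>K\<^sub>r\<close> into \<open>m\<close> copies of \<open>K\<^sub>n\<^sub>+\<^sub>1\<close> that share \<open>r + 1\<close> vertices. One copy is a clique of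
  size \<open>n + 1\<close>, and a local antimagic labeling induces a proper colouring, so at least \<open>n + 1\<close>
  values occur (\<open>clique_card_le_colours\<close>). It remains to find a labeling under which each of the
  \<open>s = n - r\<close> private vertices of a copy gets the same sum as its counterparts in the other copies,
  while the \<open>n + 1\<close> sums within one copy are different (\<open>chi_la_join_amalg_eqI\<close>).

  The \<open>m\<close> edges that correspond to each other in the copies form an edge type. A type gets
  labels which are an affine function of the copy number \<open>i\<close>. Usually they are a block of \<open>m\<close>
  consecutive numbers, in increasing or in decreasing order, so the slope is \<open>1\<close> or \<open>-1\<close>. The sum at
  a private vertex is independent of the copy exactly when the slopes of its \<open>n\<close> types add up to
  zero. With slopes \<open>1\<close> and \<open>-1\<close> only, this needs \<open>n\<close> to be even. For odd \<open>n\<close>, the types that join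
  the private vertices to one fixed shared vertex are given slope \<open>2\<close>: two such types interleave on a
  stretch of \<open>2 m\<close> numbers. With this change the slopes can always be balanced
  (\<open>sum_slope_eq_0\<close>). If \<open>s\<close> is odd too, one type of slope \<open>2\<close> has no partner, and the gaps between
  its labels are filled with labels of edges between shared vertices. There are \<open>m - 1\<close> gaps, and
  there are \<open>r + 1\<close> over \<open>2\<close> such edges; the hypotheses of the theorem guarantee that these suffice, since
  \<open>r \<ge> 2\<close> in this case.

  Distinctness of the sums comes from the order in which blocks are handed out. Number the
  vertices of a copy so that the private ones precede the shared ones, and order the types by their
  larger end and then by their smaller end, except that the edges between shared vertices come last.
  Replacing an end of an edge by a later vertex then increases its label
  (\<open>edge_label_mono_first\<close>), and comparing the sums term by term shows that they increase
  along the numbering. A shared vertex has additional edges in the other copies, which only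
  add to its sum.
\<close>

section \<open>The join as complete graphs with a common clique\<close>

text \<open>
  The vertex at position \<open>p \<le> r + s\<close> of copy \<open>i\<close>, with copies counted from \<open>0\<close>. The private vertices
  take the positions below \<open>s\<close>, the vertex added by the join takes position \<open>s\<close>, and the identified
  vertices follow. Putting the shared vertices last makes the colours increase with the position.
\<close>
definition vtx :: "nat \<Rightarrow> nat \<Rightarrow> nat \<Rightarrow> nat \<Rightarrow> (nat \<times> nat) option" where
  "vtx r s i p = (if p < s then Some (Suc i, r + 1 + p) else if p = s then None else Some (1, p - s))"

lemma vtx_eq_iff:
  assumes "p \<le> r + s" "p' \<le> r + s"
  shows "vtx r s i p = vtx r s i' p' \<longleftrightarrow> p = p' \<and> (p < s \<longrightarrow> i = i')"
  using assms by (auto simp: vtx_def)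

lemma vtx_shared: "s \<le> p \<Longrightarrow> vtx r s i p = vtx r s i' p"
  by (simp add: vtx_def)

lemma Some_amalg_vertex:
  assumes "1 \<le> j"
  shows "Some (amalg_vertex r (Suc i) j) = vtx r s i (if j \<le> r then s + j else j - r - 1) \<or> r + s < j"
  using assms by (auto simp: amalg_vertex_def vtx_def)

lemma vtx_eq_Some:
  assumes "p \<le> r + s" "p \<noteq> s"
  shows "vtx r s i p = Some (amalg_vertex r (Suc i) (if p < s then r + 1 + p else p - s))"
  using assms by (auto simp: amalg_vertex_def vtx_def)

lemma amalg_vertex_in_verts:
  assumes "i < m" "1 \<le> j" "j \<le> n"
  shows "amalg_vertex r (Suc i) j \<in> verts (amalg_complete m n r)"
proof -
  have "1 \<le> Suc i" "Suc i \<le> m" using assms by auto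
  with assms(2,3) show ?thesis unfolding verts_def amalg_complete_def fst_conv by blast
qed

lemma verts_join_amalg:
  assumes "0 < m"
  shows "verts (join_K1 (amalg_complete m (r + s) r)) = {vtx r s i p | i p. i < m \<and> p \<le> r + s}"
    (is "?L = ?R")
proof
  show "?L \<subseteq> ?R"
  proof
    fix v assume "v \<in> ?L"
    then consider "v = None" | i j where "1 \<le> i" "i \<le> m" "1 \<le> j" "j \<le> r + s" "v = Some (amalg_vertex r i j)"
      by (auto simp: verts_def join_K1_def amalg_complete_def)
    then show "v \<in> ?R"
    proof cases
      case 1
      then have "v = vtx r s 0 s" by (simp add: vtx_def)
      with assms show ?thesis by fastforce
    next
      case 2
      then obtain i' where "i = Suc i'" by (cases i) auto
      with 2 have "v = vtx r s i' (if j \<le> r then s + j else j - r - 1)"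
        using Some_amalg_vertex[of j r i' s] by auto
      moreover have "(if j \<le> r then s + j else j - r - 1) \<le> r + s" using 2 by auto
      moreover have "i' < m" using 2 \<open>i = Suc i'\<close> by simp
      ultimately show ?thesis by blast
    qed
  qed
  show "?R \<subseteq> ?L"
  proof
    fix v assume "v \<in> ?R"
    then obtain i p where v: "i < m" "p \<le> r + s" "v = vtx r s i p" by auto
    show "v \<in> ?L"
    proof (cases "p = s")
      case True
      with v show ?thesis by (simp add: vtx_def verts_def join_K1_def)
    next
      case False
      with v have "v = Some (amalg_vertex r (Suc i) (if p < s then r + 1 + p else p - s))"
        using vtx_eq_Some[of p r s i] by simp
      moreover have "1 \<le> (if p < s then r + 1 + p else p - s)" "(if p < s then r + 1 + p else p - s) \<le> r + s"
        using v False by auto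
      ultimately have "v \<in> Some ` verts (amalg_complete m (r + s) r)"
        using v(1) amalg_vertex_in_verts by simp
      then show ?thesis unfolding verts_def join_K1_def by simp
    qed
  qed
qed

lemma edges_join_amalg:
  assumes "0 < m"
  shows "edges (join_K1 (amalg_complete m (r + s) r)) =
    {{vtx r s i j, vtx r s i k} | i j k. i < m \<and> j \<le> r + s \<and> k \<le> r + s \<and> j \<noteq> k}"
    (is "?L = ?R")
proof
  let ?p = "\<lambda>j. if j \<le> r then s + j else j - r - 1"
  let ?c = "\<lambda>p. if p < s then r + 1 + p else p - s"
  have p_le: "?p j \<le> r + s" "?p j \<noteq> s" if "1 \<le> j" "j \<le> r + s" for j using that by auto
  have p_inj: "?p j \<noteq> ?p k" if "1 \<le> j" "j \<le> r + s" "1 \<le> k" "k \<le> r + s" "j \<noteq> k" for j k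
    using that by auto
  have p_vtx: "Some (amalg_vertex r (Suc i) j) = vtx r s i (?p j)" if "1 \<le> j" "j \<le> r + s" for i j
    using Some_amalg_vertex[OF that(1), of r i s] that by auto
  have None: "None = vtx r s i s" for i by (simp add: vtx_def)
  show "?L \<subseteq> ?R"
  proof
    fix e assume "e \<in> ?L"
    then consider
      (old) i j k where "1 \<le> i" "i \<le> m" "1 \<le> j" "j < k" "k \<le> r + s"
          "e = {Some (amalg_vertex r i j), Some (amalg_vertex r i k)}"
      | (new) i j where "1 \<le> i" "i \<le> m" "1 \<le> j" "j \<le> r + s" "e = {None, Some (amalg_vertex r i j)}"
      by (auto simp: edges_def verts_def join_K1_def amalg_complete_def)
    then show "e \<in> ?R"
    proof cases
      case old
      obtain i' where i': "i = Suc i'" using old by (cases i) auto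
      have "e = {vtx r s i' (?p j), vtx r s i' (?p k)}"
        using old i' p_vtx[of j i'] p_vtx[of k i'] by simp
      moreover have "?p j \<le> r + s" "?p k \<le> r + s" "?p j \<noteq> ?p k"
        using old p_le[of j] p_le[of k] p_inj[of j k] by auto
      moreover have "i' < m" using old i' by simp
      ultimately show ?thesis by blast
    next
      case new
      obtain i' where i': "i = Suc i'" using new by (cases i) auto
      have "e = {vtx r s i' s, vtx r s i' (?p j)}"
        using new i' p_vtx[of j i'] None by simp
      moreover have "s \<le> r + s" "?p j \<le> r + s" "s \<noteq> ?p j"
        using new p_le[of j] by auto
      moreover have "i' < m" using new i' by simp
      ultimately show ?thesis by blast
    qed
  qed
  have c_le: "1 \<le> ?c p" "?c p \<le> r + s" if "p \<le> r + s" "p \<noteq> s" for p using that by auto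
  have c_inj: "?c p \<noteq> ?c p'" if "p \<le> r + s" "p \<noteq> s" "p' \<le> r + s" "p' \<noteq> s" "p \<noteq> p'" for p p'
    using that by auto
  have new: "{None, vtx r s i p} \<in> ?L" if "i < m" "p \<le> r + s" "p \<noteq> s" for i p
  proof -
    have "amalg_vertex r (Suc i) (?c p) \<in> verts (amalg_complete m (r + s) r)"
      using that(1) c_le[OF that(2,3)] by (rule amalg_vertex_in_verts)
    then have "{None, Some (amalg_vertex r (Suc i) (?c p))} \<in> ?L"
      unfolding join_K1_def edges_def snd_conv by blast
    then show ?thesis unfolding vtx_eq_Some[OF that(2,3)] .
  qed
  have old': "{Some (amalg_vertex r (Suc i) j), Some (amalg_vertex r (Suc i) k)} \<in> ?L"
    if "i < m" "1 \<le> j" "j < k" "k \<le> r + s" for i j k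
  proof -
    have "1 \<le> Suc i" "Suc i \<le> m" using that by auto
    with that(2-) have "{amalg_vertex r (Suc i) j, amalg_vertex r (Suc i) k} \<in> edges (amalg_complete m (r + s) r)"
      unfolding edges_def amalg_complete_def snd_conv by blast
    then have "Some ` {amalg_vertex r (Suc i) j, amalg_vertex r (Suc i) k} \<in> ?L"
      unfolding join_K1_def edges_def snd_conv by blast
    then show ?thesis by simp
  qed
  have old: "{vtx r s i p, vtx r s i p'} \<in> ?L"
    if "i < m" "p \<le> r + s" "p \<noteq> s" "p' \<le> r + s" "p' \<noteq> s" "p \<noteq> p'" for i p p'
  proof -
    from c_inj[OF that(2-)] consider "?c p < ?c p'" | "?c p' < ?c p" by linarith
    then show ?thesis
    proof cases
      case 1
      from old'[OF that(1) c_le(1)[OF that(2,3)] 1 c_le(2)[OF that(4,5)]]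
      show ?thesis unfolding vtx_eq_Some[OF that(2,3)] vtx_eq_Some[OF that(4,5)] .
    next
      case 2
      from old'[OF that(1) c_le(1)[OF that(4,5)] 2 c_le(2)[OF that(2,3)]]
      show ?thesis unfolding vtx_eq_Some[OF that(2,3)] vtx_eq_Some[OF that(4,5)]
        by (simp only: insert_commute)
    qed
  qed
  show "?R \<subseteq> ?L"
  proof
    fix e assume "e \<in> ?R"
    then obtain i j k where e: "i < m" "j \<le> r + s" "k \<le> r + s" "j \<noteq> k" "e = {vtx r s i j, vtx r s i k}"
      by auto
    consider "j = s" | "k = s" | "j \<noteq> s" "k \<noteq> s" by blast
    then show "e \<in> ?L"
    proof cases
      case 1
      with e new[of i k] None[of i] show ?thesis by simp
    next
      case 2
      with e new[of i j] None[of i] show ?thesis by (simp add: insert_commute)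
    next
      case 3
      with e old[of i j k] show ?thesis by simp
    qed
  qed
qed

lemma edge_joinI:
  assumes "i < m" "j \<le> r + s" "k \<le> r + s" "j \<noteq> k"
  shows "{vtx r s i j, vtx r s i k} \<in> edges (join_K1 (amalg_complete m (r + s) r))"
proof -
  have "0 < m" using assms(1) by simp
  then show ?thesis unfolding edges_join_amalg[OF \<open>0 < m\<close>] mem_Collect_eq
    by (intro exI[of _ i] exI[of _ j] exI[of _ k] conjI assms refl)
qed

lemma edge_joinE:
  assumes "e \<in> edges (join_K1 (amalg_complete m (r + s) r))" "0 < m"
  obtains i j k where "i < m" "j \<le> r + s" "k \<le> r + s" "j \<noteq> k" "e = {vtx r s i j, vtx r s i k}"
  using assms(1) unfolding edges_join_amalg[OF assms(2)] by (elim CollectE exE conjE) (rule that)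

section \<open>Reduction to a labeling of positions\<close>

text \<open>
  Adjacent vertices get different sums, so the sums are injective on a clique.
\<close>
lemma clique_card_le_colours:
  assumes "local_antimagic H g" "finite (verts H)" "K \<subseteq> verts H"
    and clique: "\<And>u v. u \<in> K \<Longrightarrow> v \<in> K \<Longrightarrow> u \<noteq> v \<Longrightarrow> {u, v} \<in> edges H"
  shows "card K \<le> card (induced_label H g ` verts H)"
proof -
  have "inj_on (induced_label H g) K"
    using assms(1) clique unfolding inj_on_def local_antimagic_def by metis
  then have "card K = card (induced_label H g ` K)" by (simp add: card_image)
  also have "\<dots> \<le> card (induced_label H g ` verts H)"
    using assms by (intro card_mono) auto
  finally show ?thesis .
qed

lemma induced_label_private:
  assumes "i < m" "j < s"
  shows "induced_label (join_K1 (amalg_complete m (r + s) r)) g (vtx r s i j) =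
    (\<Sum>k\<in>{..r + s} - {j}. g {vtx r s i j, vtx r s i k})"
proof -
  have m: "0 < m" using assms by simp
  let ?E = "edges (join_K1 (amalg_complete m (r + s) r))"
  have "{x. {vtx r s i j, x} \<in> ?E} = vtx r s i ` ({..r + s} - {j})" (is "?L = ?R")
  proof
    show "?L \<subseteq> ?R"
    proof
      fix x assume "x \<in> ?L"
      then obtain i' a b where h: "i' < m" "a \<le> r + s" "b \<le> r + s" "a \<noteq> b"
        "{vtx r s i j, x} = {vtx r s i' a, vtx r s i' b}"
        using m by (elim CollectE edge_joinE)
      have j: "j \<le> r + s" using assms by simp
      from h(5) consider "vtx r s i j = vtx r s i' a" "x = vtx r s i' b"
        | "vtx r s i j = vtx r s i' b" "x = vtx r s i' a" by (auto simp: doubleton_eq_iff)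
      then show "x \<in> ?R"
        by cases (use h assms j in \<open>auto simp: vtx_eq_iff\<close>)
    qed
    show "?R \<subseteq> ?L"
    proof
      fix x assume "x \<in> ?R"
      then obtain k where "k \<le> r + s" "k \<noteq> j" "x = vtx r s i k" by auto
      moreover have "j \<le> r + s" using assms by simp
      ultimately show "x \<in> ?L" using assms(1) edge_joinI[of i m j r s k] by simp
    qed
  qed
  moreover have "inj_on (vtx r s i) ({..r + s} - {j})"
    by (auto simp: inj_on_def vtx_eq_iff)
  ultimately show ?thesis
    unfolding induced_label_def by (simp add: sum.reindex)
qed

text \<open>
  A shared vertex sees every other shared vertex once and every private vertex once per copy.
\<close>
lemma induced_label_shared:
  assumes "0 < m" "s \<le> j" "j \<le> r + s"
  shows "induced_label (join_K1 (amalg_complete m (r + s) r)) g (vtx r s i0 j) =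
    (\<Sum>k\<in>{s..r + s} - {j}. g {vtx r s 0 j, vtx r s 0 k}) +
    (\<Sum>k<s. \<Sum>i<m. g {vtx r s i j, vtx r s i k})"
proof -
  let ?E = "edges (join_K1 (amalg_complete m (r + s) r))"
  let ?A = "vtx r s 0 ` ({s..r + s} - {j})" and ?B = "(\<lambda>(k, i). vtx r s i k) ` ({..<s} \<times> {..<m})"
  have "{x. {vtx r s i0 j, x} \<in> ?E} = ?A \<union> ?B" (is "?L = ?R")
  proof
    show "?L \<subseteq> ?R"
    proof
      fix x assume "x \<in> ?L"
      then obtain i' a b where h: "i' < m" "a \<le> r + s" "b \<le> r + s" "a \<noteq> b"
        "{vtx r s i0 j, x} = {vtx r s i' a, vtx r s i' b}"
        using assms(1) by (elim CollectE edge_joinE)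
      then obtain b' where b': "b' \<le> r + s" "b' \<noteq> j" "x = vtx r s i' b'"
      proof -
        have "vtx r s i0 j = vtx r s i' a \<and> x = vtx r s i' b \<or> vtx r s i0 j = vtx r s i' b \<and> x = vtx r s i' a"
          using h(5) by (simp add: doubleton_eq_iff)
        then show ?thesis
          using h(2-4) assms(3) that[of a] that[of b] by (auto simp: vtx_eq_iff)
      qed
      show "x \<in> ?R"
      proof (cases "b' < s")
        case True
        with h(1) have "(b', i') \<in> {..<s} \<times> {..<m}" by simp
        moreover have "x = (\<lambda>(k, i). vtx r s i k) (b', i')" using b' by simp
        ultimately have "x \<in> ?B" by (rule rev_image_eqI)
        then show ?thesis by blast
      next
        case False
        then have "s \<le> b'" by simp
        then have "x = vtx r s 0 b'" unfolding b'(3) by (rule vtx_shared)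
        moreover have "b' \<in> {s..r + s} - {j}" using False b' by simp
          ultimately have "x \<in> ?A" by (rule image_eqI)
        then show ?thesis by blast
      qed
    qed
    have "{vtx r s i0 j, vtx r s i k} \<in> ?E" if "i < m" "k \<noteq> j" "k \<le> r + s" for i k
    proof -
      have "{vtx r s i j, vtx r s i k} \<in> ?E"
        using that assms by (intro edge_joinI) auto
      moreover have "vtx r s i0 j = vtx r s i j" using assms by (intro vtx_shared)
      ultimately show ?thesis by simp
    qed
    note nbr = this
    show "?R \<subseteq> ?L"
    proof
      fix x assume "x \<in> ?R"
      then show "x \<in> ?L"
      proof
        assume "x \<in> ?A"
        then obtain k where "k \<in> {s..r + s} - {j}" "x = vtx r s 0 k" by (rule imageE)
        then show ?thesis using nbr[of 0 k] assms(1) by simp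
      next
        assume "x \<in> ?B"
        then obtain k i where "k < s" "i < m" "x = vtx r s i k" by auto
        then show ?thesis using nbr[of i k] assms(2,3) by simp
      qed
    qed
  qed
  moreover have "?A \<inter> ?B = {}" by (auto simp: vtx_eq_iff)
  moreover have "finite ?A" "finite ?B" by (intro finite_imageI finite_cartesian_product; simp)+
  moreover have injA: "inj_on (vtx r s 0) ({s..r + s} - {j})"
    by (auto simp: inj_on_def vtx_eq_iff)
  moreover have injB: "inj_on (\<lambda>(k, i). vtx r s i k) ({..<s} \<times> {..<m})"
    by (auto simp: inj_on_def vtx_eq_iff)
  ultimately have "induced_label (join_K1 (amalg_complete m (r + s) r)) g (vtx r s i0 j) =
     (\<Sum>x\<in>?A. g {vtx r s i0 j, x}) + (\<Sum>x\<in>?B. g {vtx r s i0 j, x})"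
    unfolding induced_label_def by (simp only: sum.union_disjoint)
  also have "\<dots> = (\<Sum>k\<in>{s..r + s} - {j}. g {vtx r s i0 j, vtx r s 0 k}) +
     (\<Sum>(k, i)\<in>{..<s} \<times> {..<m}. g {vtx r s i0 j, vtx r s i k})"
    unfolding sum.reindex[OF injA] sum.reindex[OF injB] by (simp add: case_prod_unfold o_def)
  also have "\<dots> = (\<Sum>k\<in>{s..r + s} - {j}. g {vtx r s 0 j, vtx r s 0 k}) +
    (\<Sum>k<s. \<Sum>i<m. g {vtx r s i j, vtx r s i k})"
  proof -
    have eq: "g {vtx r s i0 j, vtx r s i k} = g {vtx r s i j, vtx r s i k}" for i k
      unfolding vtx_shared[OF assms(2), of r i0 i] ..
    have e1: "(\<Sum>k\<in>{s..r + s} - {j}. g {vtx r s i0 j, vtx r s 0 k}) =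
        (\<Sum>k\<in>{s..r + s} - {j}. g {vtx r s 0 j, vtx r s 0 k})"
      by (intro sum.cong refl) (rule eq)
    have e2: "(\<Sum>(k, i)\<in>{..<s} \<times> {..<m}. g {vtx r s i0 j, vtx r s i k}) =
        (\<Sum>k<s. \<Sum>i<m. g {vtx r s i0 j, vtx r s i k})"
      by (rule sum.cartesian_product[symmetric])
    have e3: "\<dots> = (\<Sum>k<s. \<Sum>i<m. g {vtx r s i j, vtx r s i k})"
      by (intro sum.cong refl) (rule eq)
    show ?thesis unfolding e1 e2 e3 ..
  qed
  finally show ?thesis .
qed

text \<open>
  One triple for each edge: an edge between two shared vertices lies in all copies and is
  listed for copy \<open>0\<close> only.
\<close>
definition edge_index :: "nat \<Rightarrow> nat \<Rightarrow> nat \<Rightarrow> (nat \<times> nat \<times> nat) set" where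
  "edge_index m r s = {(i, j, k). i < m \<and> j < k \<and> k \<le> r + s \<and> (s \<le> j \<longrightarrow> i = 0)}"

lemma bij_betw_edge_index:
  assumes "0 < m"
  shows "bij_betw (\<lambda>(i, j, k). {vtx r s i j, vtx r s i k}) (edge_index m r s)
    (edges (join_K1 (amalg_complete m (r + s) r)))" (is "bij_betw ?\<phi> _ ?E")
  unfolding bij_betw_def
proof
  show "inj_on ?\<phi> (edge_index m r s)"
  proof (rule inj_onI)
    fix x y assume "x \<in> edge_index m r s" "y \<in> edge_index m r s" "?\<phi> x = ?\<phi> y"
    moreover obtain i j k i' j' k' where xy: "x = (i, j, k)" "y = (i', j', k')" by (cases x, cases y)
    ultimately have P: "(i, j, k) \<in> edge_index m r s" "(i', j', k') \<in> edge_index m r s"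
      and "{vtx r s i j, vtx r s i k} = {vtx r s i' j', vtx r s i' k'}" by simp_all
    then have "vtx r s i j = vtx r s i' j' \<and> vtx r s i k = vtx r s i' k' \<or>
        vtx r s i j = vtx r s i' k' \<and> vtx r s i k = vtx r s i' j'"
      by (simp add: doubleton_eq_iff)
    with P show "x = y" unfolding xy
      by (auto simp: edge_index_def vtx_eq_iff)
  qed
  show "?\<phi> ` edge_index m r s = ?E"
  proof
    show "?\<phi> ` edge_index m r s \<subseteq> ?E"
      by (auto simp: edge_index_def intro!: edge_joinI)
    have *: "{vtx r s i j, vtx r s i k} \<in> ?\<phi> ` edge_index m r s"
      if "i < m" "j < k" "k \<le> r + s" for i j k
    proof (cases "s \<le> j")
      case True
      then have "{vtx r s i j, vtx r s i k} = {vtx r s 0 j, vtx r s 0 k}"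
        using that vtx_shared[of s j r i 0] vtx_shared[of s k r i 0] by simp
      moreover have "(0, j, k) \<in> edge_index m r s" using that by (simp add: edge_index_def)
      ultimately show ?thesis by (intro image_eqI[of _ _ "(0, j, k)"]) simp_all
    next
      case False
      then have "(i, j, k) \<in> edge_index m r s" using that by (simp add: edge_index_def)
      then show ?thesis by (intro image_eqI[of _ _ "(i, j, k)"]) simp_all
    qed
    show "?E \<subseteq> ?\<phi> ` edge_index m r s"
    proof
      fix e assume "e \<in> ?E"
      then obtain i j k where e: "i < m" "j \<le> r + s" "k \<le> r + s" "j \<noteq> k" "e = {vtx r s i j, vtx r s i k}"
        using assms by (rule edge_joinE)
      show "e \<in> ?\<phi> ` edge_index m r s"
      proof (cases "j < k")
        case True
        then show ?thesis unfolding e(5) using * e by blast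
      next
        case False
        then show ?thesis unfolding e(5) insert_commute[of "vtx r s i j"] using *[of i k j] e by simp
      qed
    qed
  qed
qed

text \<open>
  A labeling may be given as a function of a copy and two positions. If the sum at each
  position is the same in all copies, then only \<open>r + s + 1\<close> sums occur; if these differ, the
  labeling is local antimagic, and the clique formed by one copy shows that it is optimal.
\<close>
lemma chi_la_join_amalg_eqI:
  fixes f :: "nat \<Rightarrow> nat \<Rightarrow> nat \<Rightarrow> nat" and F :: "nat \<Rightarrow> nat"
  assumes "0 < m"
    and sym: "\<And>i j k. f i j k = f i k j"
    and shared: "\<And>i j k. s \<le> j \<Longrightarrow> s \<le> k \<Longrightarrow> f i j k = f 0 j k"
    and bij: "bij_betw (\<lambda>(i, j, k). f i j k) (edge_index m r s) {1..card (edge_index m r s)}"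
    and F_private: "\<And>i j. i < m \<Longrightarrow> j < s \<Longrightarrow> (\<Sum>k\<in>{..r + s} - {j}. f i j k) = F j"
    and F_shared: "\<And>j. s \<le> j \<Longrightarrow> j \<le> r + s \<Longrightarrow>
      (\<Sum>k\<in>{s..r + s} - {j}. f 0 j k) + (\<Sum>k<s. \<Sum>i<m. f i j k) = F j"
    and inj: "inj_on F {..r + s}"
  shows "chi_la (join_K1 (amalg_complete m (r + s) r)) = r + s + 1"
proof -
  let ?H = "join_K1 (amalg_complete m (r + s) r)"
  let ?\<phi> = "\<lambda>(i, j, k). {vtx r s i j, vtx r s i k}"
  note \<phi> = bij_betw_edge_index[OF \<open>0 < m\<close>, of r s]
  define g where "g = (\<lambda>(i, j, k). f i j k) \<circ> the_inv_into (edge_index m r s) ?\<phi>"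
  have g_idx: "g {vtx r s i j, vtx r s i k} = f i j k" if "(i, j, k) \<in> edge_index m r s" for i j k
    using the_inv_into_f_f[OF bij_betw_imp_inj_on[OF \<phi>] that] by (simp add: g_def)
  have g_less: "g {vtx r s i j, vtx r s i k} = f i j k" if "i < m" "j < k" "k \<le> r + s" for i j k
  proof (cases "s \<le> j")
    case True
    then have "{vtx r s i j, vtx r s i k} = {vtx r s 0 j, vtx r s 0 k}"
      using that vtx_shared[of s j r i 0] vtx_shared[of s k r i 0] by simp
    moreover have "(0, j, k) \<in> edge_index m r s" using that by (simp add: edge_index_def)
    ultimately show ?thesis using g_idx[of 0 j k] shared[of j k i] True that by simp
  next
    case False
    then show ?thesis using that by (intro g_idx) (simp add: edge_index_def)
  qed
  have g: "g {vtx r s i j, vtx r s i k} = f i j k"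
    if "i < m" "j \<noteq> k" "j \<le> r + s" "k \<le> r + s" for i j k
    using g_less[of i j k] g_less[of i k j] that sym[of i j k]
    by (cases "j < k") (simp_all add: insert_commute)
  have colour: "induced_label ?H g (vtx r s i j) = F j" if "i < m" "j \<le> r + s" for i j
  proof (cases "j < s")
    case True
    then show ?thesis
      using that g[of i j] F_private[of i j] by (simp add: induced_label_private)
  next
    case False
    have "(\<Sum>k\<in>{s..r + s} - {j}. g {vtx r s 0 j, vtx r s 0 k}) = (\<Sum>k\<in>{s..r + s} - {j}. f 0 j k)"
      using that \<open>0 < m\<close> by (intro sum.cong refl g) auto
    moreover have "(\<Sum>k<s. \<Sum>i<m. g {vtx r s i j, vtx r s i k}) = (\<Sum>k<s. \<Sum>i<m. f i j k)"
      using that False by (intro sum.cong refl g) auto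
    ultimately show ?thesis
      using that False \<open>0 < m\<close> F_shared[of j] by (simp add: induced_label_shared)
  qed
  have "bij_betw g (edges ?H) {1..card (edge_index m r s)}"
    unfolding g_def using bij_betw_trans[OF bij_betw_the_inv_into[OF \<phi>] bij] .
  moreover have "card (edges ?H) = card (edge_index m r s)"
    using bij_betw_same_card[OF \<phi>] by simp
  moreover have "induced_label ?H g u \<noteq> induced_label ?H g v" if "{u, v} \<in> edges ?H" for u v
  proof -
    from that \<open>0 < m\<close> obtain i j k where e: "i < m" "j \<le> r + s" "k \<le> r + s" "j \<noteq> k"
      "{u, v} = {vtx r s i j, vtx r s i k}" by (rule edge_joinE)
    have "F j \<noteq> F k" using inj_onD[OF inj, of j k] e by auto
    with e(5) show ?thesis using colour[OF e(1,2)] colour[OF e(1,3)] by (auto simp: doubleton_eq_iff)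
  qed
  ultimately have anti: "local_antimagic ?H g" by (simp add: local_antimagic_def)
  have verts: "verts ?H = {vtx r s i p | i p. i < m \<and> p \<le> r + s}"
    using \<open>0 < m\<close> by (rule verts_join_amalg)
  have "induced_label ?H g ` verts ?H \<subseteq> F ` {..r + s}"
    unfolding verts using colour by auto
  then have upper: "card (induced_label ?H g ` verts ?H) \<le> r + s + 1"
    using surj_card_le[of "{..r + s}" _ F] by simp
  have lower: "r + s + 1 \<le> card (induced_label ?H g' ` verts ?H)" if "local_antimagic ?H g'" for g'
  proof -
    have "inj_on (vtx r s 0) {..r + s}" by (auto simp: inj_on_def vtx_eq_iff)
    then have "r + s + 1 = card (vtx r s 0 ` {..r + s})" by (simp add: card_image)
    also have "\<dots> \<le> card (induced_label ?H g' ` verts ?H)"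
    proof (rule clique_card_le_colours[OF that])
      show "finite (verts ?H)"
        using simple_graph_join_K1[OF simple_graph_amalg_complete] by (simp add: simple_graph_def)
      show "vtx r s 0 ` {..r + s} \<subseteq> verts ?H"
        unfolding verts using \<open>0 < m\<close> by auto
      show "{u, v} \<in> edges ?H" if "u \<in> vtx r s 0 ` {..r + s}" "v \<in> vtx r s 0 ` {..r + s}" "u \<noteq> v" for u v
        using that \<open>0 < m\<close> by (auto intro!: edge_joinI)
    qed
    finally show ?thesis .
  qed
  show ?thesis
    unfolding chi_la_def
  proof (rule antisym)
    show "Inf {card (induced_label ?H g ` verts ?H) |g. local_antimagic ?H g} \<le> r + s + 1"
      using anti upper by (intro cInf_lower2[of "card (induced_label ?H g ` verts ?H)"]) auto
    show "r + s + 1 \<le> Inf {card (induced_label ?H g ` verts ?H) |g. local_antimagic ?H g}"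
      using anti lower by (intro cInf_greatest) auto
  qed
qed

section \<open>Balanced slopes\<close>

text \<open>
  Within the private vertices the slope is \<open>(-1)\<close> to the power \<open>j + k\<close>, so at position \<open>j\<close> these
  slopes add up to \<open>-u\<close>, where \<open>u\<close> is the bracketed term \<open>1\<close>, \<open>0\<close> or \<open>2\<close>. The
  slopes towards the \<open>r + 1\<close> shared vertices must add up to \<open>u\<close>. With \<open>p\<close> positive signs and no slope \<open>2\<close>
  this says \<open>2 p - (r + 1) = u\<close>; if one of the slopes is \<open>2\<close>, it says
  \<open>2 + 2 p - r = u\<close>. Solving for \<open>p\<close> gives the formula.
\<close>
definition plus_count :: "nat \<Rightarrow> nat \<Rightarrow> nat \<Rightarrow> nat" where
  "plus_count r s j =
     (r + 1 + (if even s then 1 else if even j then 0 else 2) - (if odd (r + s) then 3 else 0)) div 2"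

definition slope :: "nat \<Rightarrow> nat \<Rightarrow> nat \<Rightarrow> nat \<Rightarrow> int" where
  "slope r s j k =
     (if k < s then (-1) ^ (j + k)
      else if odd (r + s) \<and> k = r + s then 2
      else if k - s < plus_count r s j then 1 else -1)"

lemma sum_alternating: "(\<Sum>k<s. (-1) ^ k) = (if odd s then 1 else 0 :: int)"
  by (induction s) auto

lemma sum_prefix_signs:
  "p \<le> l \<Longrightarrow> (\<Sum>x<l. if x < p then 1 else -1 :: int) = 2 * int p - int l"
proof (induction l)
  case (Suc l)
  show ?case
  proof (cases "p = Suc l")
    case True
    have "(\<Sum>x<Suc l. if x < p then 1 else -1 :: int) = (\<Sum>x<Suc l. 1)"
      using True by (intro sum.cong) auto
    with True show ?thesis by simp
  qed (use Suc in auto)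
qed simp

text \<open>
  The parities work out in all four cases, and \<open>r \<ge> 1\<close> makes the number of positive signs
  lie within its range. In particular, if \<open>r + s\<close> and \<open>s\<close> are odd then \<open>r \<ge> 2\<close>, so the truncated
  subtraction of \<open>3\<close> is exact.
\<close>
lemma sum_slope_eq_0:
  assumes "1 \<le> r" "j < s"
  shows "(\<Sum>k\<in>{..r + s} - {j}. slope r s j k) = 0"
proof -
  let ?p = "plus_count r s j"
  have "(\<Sum>k\<in>{..<s} - {j}. slope r s j k) = (-1) ^ j * (\<Sum>k\<in>{..<s} - {j}. (-1) ^ k)"
    by (simp add: slope_def sum_distrib_left power_add)
  also have "(\<Sum>k\<in>{..<s} - {j}. (-1) ^ k) = (\<Sum>k<s. (-1) ^ k) - (-1 :: int) ^ j"
    using assms by (simp add: sum_diff1)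
  also have "(-1) ^ j * \<dots> = (if odd s then (-1) ^ j else 0) - 1"
    by (simp add: sum_alternating algebra_simps power_add[symmetric] mult_2[symmetric])
  finally have priv: "(\<Sum>k\<in>{..<s} - {j}. slope r s j k) = (if odd s then (-1) ^ j else 0) - 1" .
  have sgn: "(\<Sum>k\<in>{s..<s + l}. if k - s < ?p then 1 else -1 :: int) = 2 * int ?p - int l" if "?p \<le> l" for l
    using sum_prefix_signs[OF that]
    by (subst sum.atLeastLessThan_shift_0) (simp add: atLeast0LessThan)
  have shared: "(\<Sum>k\<in>{s..r + s}. slope r s j k) = 1 - (if odd s then (-1) ^ j else 0)"
  proof (cases "odd (r + s)")
    case True
    have p: "?p \<le> r" using True assms by (auto simp: plus_count_def)
    have "{s..r + s} = insert (r + s) {s..<s + r}" by auto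
    then have "(\<Sum>k\<in>{s..r + s}. slope r s j k) = 2 + (\<Sum>k\<in>{s..<s + r}. slope r s j k)"
      using True by (simp add: slope_def)
    also have "(\<Sum>k\<in>{s..<s + r}. slope r s j k) = 2 * int ?p - int r"
      unfolding sgn[OF p, symmetric] by (intro sum.cong) (auto simp: slope_def)
    also have "2 * int ?p = int r - 1 - (if odd s then (-1) ^ j else 0)"
      using True assms unfolding plus_count_def
      by (cases "even s"; cases "even j"; simp; presburger)
    finally have "(\<Sum>k\<in>{s..r + s}. slope r s j k) = 2 + (int r - 1 - (if odd s then (-1) ^ j else 0) - int r)" .
    then show ?thesis by simp
  next
    case False
    have p: "?p \<le> r + 1" using False assms by (auto simp: plus_count_def)
    have "{s..r + s} = {s..<s + (r + 1)}" by auto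
    then have "(\<Sum>k\<in>{s..r + s}. slope r s j k) = 2 * int ?p - int (r + 1)"
      unfolding sgn[OF p, symmetric] using False by (intro sum.cong) (auto simp: slope_def)
    also have "\<dots> = 1 - (if odd s then (-1) ^ j else 0)"
      using False assms unfolding plus_count_def
      by (cases "even s"; cases "even j"; auto elim!: evenE oddE)
    finally show ?thesis .
  qed
  have "{..r + s} - {j} = ({..<s} - {j}) \<union> {s..r + s}" using assms by auto
  moreover have "({..<s} - {j}) \<inter> {s..r + s} = {}" by auto
  ultimately show ?thesis
    using priv shared by (simp add: sum.union_disjoint)
qed

section \<open>The labels\<close>

text \<open>
  The number of types that precede the type \<open>{j, k}\<close> with \<open>j < k\<close> and \<open>j < s\<close>, when types are ordered by
  \<open>k\<close> and then by \<open>j\<close>: position \<open>l\<close> is the larger end of \<open>min l s\<close> types. In particular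
  \<open>block_rank s 0 (r + s)\<close> counts the types that avoid the last position.
\<close>
definition block_rank :: "nat \<Rightarrow> nat \<Rightarrow> nat \<Rightarrow> nat" where
  "block_rank s j k = (\<Sum>l<k. min l s) + j"

text \<open>The corresponding rank among the edges between shared vertices.\<close>
definition shared_rank :: "nat \<Rightarrow> nat \<Rightarrow> nat \<Rightarrow> nat" where
  "shared_rank s j k = (\<Sum>l<k. l - s) + (j - s)"

text \<open>The place of copy \<open>i\<close> in a block of \<open>m\<close> numbers that is run through upwards or downwards.\<close>
definition offset :: "nat \<Rightarrow> int \<Rightarrow> nat \<Rightarrow> nat" where
  "offset m d i = (if d = 1 then i else m - 1 - i)"

text \<open>
  The second case is the column of slope \<open>2\<close>: the types of the private positions \<open>2 a\<close> and \<open>2 a + 1\<close> share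
  a stretch of \<open>2 m\<close> numbers, one taking the odd places and the other the even ones.

  The first case describes the edges between shared vertices. Normally their labels follow all
  others without a gap. If \<open>r + s\<close> and \<open>s\<close> are odd, then private position \<open>s - 1\<close> has no partner, and its type
  occupies the odd places after \<open>m (b + s - 1)\<close>, where \<open>b = block_rank s 0 (r + s)\<close>. The edge of rank \<open>t\<close>
  then goes to place \<open>2 t + 2\<close> as long as it falls into a gap, and to place \<open>m + t + 1\<close>
  afterwards; the smaller of these two numbers is always the right one.
\<close>
definition label :: "nat \<Rightarrow> nat \<Rightarrow> nat \<Rightarrow> nat \<Rightarrow> nat \<Rightarrow> nat \<Rightarrow> nat" where
  "label m r s i j k =
     (if s \<le> j then m * (block_rank s 0 (r + s) + (s - 1)) + shared_rank s j k + 1 +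
        (if odd (r + s) \<and> odd s then min (shared_rank s j k + 1) m else m)
      else if odd (r + s) \<and> k = r + s then
        m * (block_rank s 0 (r + s) + 2 * (j div 2)) + 2 * i + j mod 2 + 1
      else m * block_rank s j k + offset m (slope r s j k) i + 1)"

lemma offset_less: "i < m \<Longrightarrow> offset m d i < m"
  by (auto simp: offset_def)

lemma label_shared:
  "s \<le> j \<Longrightarrow> label m r s i j k = m * (block_rank s 0 (r + s) + (s - 1)) + shared_rank s j k + 1 +
     (if odd (r + s) \<and> odd s then min (shared_rank s j k + 1) m else m)"
  by (simp add: label_def)

lemma label_paired:
  assumes "j < s" "odd (r + s)" "k = r + s"
  shows "label m r s i j k = m * (block_rank s 0 (r + s) + 2 * (j div 2)) + 2 * i + j mod 2 + 1"
  using assms by (simp add: label_def)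

lemma label_plain:
  assumes "j < s" "\<not> (odd (r + s) \<and> k = r + s)"
  shows "label m r s i j k = m * block_rank s j k + offset m (slope r s j k) i + 1"
  unfolding label_def using assms by (simp only: if_False not_le[symmetric])

lemma block_rank_less:
  assumes "j < k" "j < s" "k < k'"
  shows "block_rank s j k < block_rank s j' k'"
proof -
  have "block_rank s j k < (\<Sum>l<Suc k. min l s)" using assms by (simp add: block_rank_def)
  also have "\<dots> \<le> (\<Sum>l<k'. min l s)" using assms by (intro sum_mono2) auto
  finally show ?thesis by (simp add: block_rank_def)
qed

lemma block_rank_less_iff:
  assumes "j < k" "j < s" "j' < k'" "j' < s"
  shows "block_rank s j k < block_rank s j' k' \<longleftrightarrow> k < k' \<or> k = k' \<and> j < j'"
  using block_rank_less[of j k s k' j'] block_rank_less[of j' k' s k j] assms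
  by (cases k k' rule: linorder_cases) (auto simp: block_rank_def)

lemma shared_rank_less:
  assumes "s \<le> j" "j < k" "k < k'"
  shows "shared_rank s j k < shared_rank s j' k'"
proof -
  have "shared_rank s j k < (\<Sum>l<Suc k. l - s)" using assms by (simp add: shared_rank_def)
  also have "\<dots> \<le> (\<Sum>l<k'. l - s)" using assms by (intro sum_mono2) auto
  finally show ?thesis by (simp add: shared_rank_def)
qed

lemma shared_rank_less_iff:
  assumes "s \<le> j" "j < k" "s \<le> j'" "j' < k'"
  shows "shared_rank s j k < shared_rank s j' k' \<longleftrightarrow> k < k' \<or> k = k' \<and> j < j'"
  using shared_rank_less[of s j k k' j'] shared_rank_less[of s j' k' k j] assms
  by (cases k k' rule: linorder_cases) (auto simp: shared_rank_def)

lemma label_affine: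
  assumes "j < s" "j < k" "k \<le> r + s" "i < m"
  shows "int (label m r s i j k) = int (label m r s 0 j k) + slope r s j k * int i"
proof (cases "odd (r + s) \<and> k = r + s")
  case True
  then show ?thesis using assms by (simp add: label_paired slope_def)
next
  case False
  have "slope r s j k = 1 \<or> slope r s j k = -1"
    using False assms by (auto simp: slope_def minus_one_power_iff)
  then show ?thesis
    using assms unfolding label_plain[OF assms(1) False] by (auto simp: offset_def)
qed

lemma mult_block_less:
  fixes m :: nat
  assumes "a < b" "c < m"
  shows "m * a + c < m * b"
proof -
  have "m * a + c < m * Suc a" using assms by simp
  also have "\<dots> \<le> m * b" using assms by (intro mult_le_mono2) simp
  finally show ?thesis .
qed

text \<open>
  At a fixed copy the order of the types carries over to their labels: distinct blocks do not
  overlap, and two interleaved types have the same slope \<open>2\<close>.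
\<close>
lemma label_mono_private:
  assumes "j < s" "j < k" "k \<le> r + s" "j' < s" "j' < k'" "k' \<le> r + s" "i < m"
    and "k < k' \<or> k = k' \<and> j < j'"
  shows "label m r s i j k < label m r s i j' k'"
proof (cases "odd (r + s) \<and> k = r + s")
  case False
  have off: "offset m (slope r s j k) i < m" using assms by (simp add: offset_less)
  show ?thesis
  proof (cases "odd (r + s) \<and> k' = r + s")
    case True
    then have "k < r + s" using False assms by auto
    then have "block_rank s j k < block_rank s 0 (r + s)" using assms by (intro block_rank_less) auto
    then have "block_rank s j k < block_rank s 0 (r + s) + 2 * (j' div 2)" by simp
    from mult_block_less[OF this off] show ?thesis
      unfolding label_plain[OF assms(1) False] using True assms(4) by (simp add: label_paired)
  next
    case plain: False
    have "block_rank s j k < block_rank s j' k'" using assms by (simp add: block_rank_less_iff)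
    from mult_block_less[OF this off] show ?thesis
      unfolding label_plain[OF assms(1) False] label_plain[OF assms(4) plain] by simp
  qed
next
  case True
  with assms have k': "k' = r + s" and "j < j'" by auto
  then consider "j div 2 = j' div 2" "j mod 2 < j' mod 2" | "j div 2 < j' div 2"
    by atomize_elim (use \<open>j < j'\<close> in presburger)
  then have "2 * (m * (j div 2)) + j mod 2 < 2 * (m * (j' div 2)) + j' mod 2"
  proof cases
    case 2
    then have "m * (j div 2) + m \<le> m * (j' div 2)"
      by (metis Suc_leI mult_Suc_right mult_le_mono2 add.commute)
    moreover have "j mod 2 < 2" by simp
    moreover have "1 \<le> m" using assms by simp
    ultimately show ?thesis by linarith
  qed simp
  with assms True k' show ?thesis by (simp add: label_paired algebra_simps)
qed

lemma label_mono_shared: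
  assumes "s \<le> j" "j < k" "s \<le> j'" "j' < k'" "k < k' \<or> k = k' \<and> j < j'"
  shows "label m r s i j k < label m r s i' j' k'"
proof -
  have "shared_rank s j k < shared_rank s j' k'" using assms by (simp add: shared_rank_less_iff)
  then show ?thesis using assms by (auto simp: label_shared)
qed

text \<open>
  The labels of the unpaired type can exceed those of edges between shared vertices; all other
  labels stay below them.
\<close>
lemma label_private_cases:
  assumes "j < s" "j < k" "k \<le> r + s" "i < m"
  obtains "odd (r + s)" "odd s"
      "label m r s i j k = m * (block_rank s 0 (r + s) + (s - 1)) + 2 * i + 1"
  | "label m r s i j k \<le> m * (block_rank s 0 (r + s) + s)"
    "odd (r + s) \<Longrightarrow> odd s \<Longrightarrow> label m r s i j k \<le> m * (block_rank s 0 (r + s) + (s - 1))"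
proof (cases "odd (r + s) \<and> k = r + s")
  case True
  have lab: "label m r s i j k = m * (block_rank s 0 (r + s) + 2 * (j div 2)) + 2 * i + j mod 2 + 1"
    using True assms by (simp add: label_paired)
  show thesis
  proof (cases "odd s \<and> j = s - 1")
    case True2: True
    then have "2 * (j div 2) = s - 1" "j mod 2 = 0" by auto
    with True True2 lab that(1) show ?thesis by simp
  next
    case False
    have le: "label m r s i j k \<le> m * (block_rank s 0 (r + s) + 2 * (j div 2 + 1))"
    proof -
      have "2 * i + j mod 2 + 1 \<le> 2 * m" using assms by (cases "even j") auto
      then show ?thesis unfolding lab by (simp add: algebra_simps)
    qed
    have "2 * (j div 2 + 1) \<le> (if odd s then s - 1 else s)"
      using assms(1) False by presburger
    then have le': "label m r s i j k \<le> m * (block_rank s 0 (r + s) + (if odd s then s - 1 else s))"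
      by (intro order_trans[OF le] mult_le_mono2) simp
    have "m * (block_rank s 0 (r + s) + (if odd s then s - 1 else s)) \<le> m * (block_rank s 0 (r + s) + s)"
      by (intro mult_le_mono2) simp
    with le' have "label m r s i j k \<le> m * (block_rank s 0 (r + s) + s)" by (rule order_trans)
    then show ?thesis using le' by (intro that(2)) (simp_all only: if_True not_False_eq_True)
  qed
next
  case False
  have lab: "label m r s i j k = m * block_rank s j k + offset m (slope r s j k) i + 1"
    by (rule label_plain[OF assms(1) False])
  have "offset m (slope r s j k) i < m" using assms by (simp add: offset_less)
  then have less: "label m r s i j k \<le> m * b" if "block_rank s j k < b" for b
    using mult_block_less[OF that, of _ m] lab by (metis Suc_eq_plus1 Suc_leI)
  have "block_rank s j k < block_rank s 0 (r + s + 1)"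
    using assms by (intro block_rank_less) auto
  also have "block_rank s 0 (r + s + 1) = block_rank s 0 (r + s) + s" by (simp add: block_rank_def)
  finally have 1: "label m r s i j k \<le> m * (block_rank s 0 (r + s) + s)" by (rule less)
  have 2: "label m r s i j k \<le> m * (block_rank s 0 (r + s) + (s - 1))" if "odd (r + s)"
  proof -
    have "k < r + s" using that False assms by simp
    then have "block_rank s j k < block_rank s 0 (r + s)" using assms by (intro block_rank_less) auto
    then show ?thesis by (intro less) simp
  qed
  show thesis using that(2) 1 2 by blast
qed

text \<open>
  In copy \<open>0\<close> the unpaired type has its smallest label, which precedes the first gap. This is
  why colours are compared in copy \<open>0\<close>.
\<close>
lemma label_private_less_shared:
  assumes "j < s" "j < k" "k \<le> r + s" "s \<le> j'" "0 < m"
  shows "label m r s 0 j k < label m r s i' j' k'"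
proof (rule label_private_cases[OF assms(1-3,5)])
  assume "odd (r + s)" "odd s" "label m r s 0 j k = m * (block_rank s 0 (r + s) + (s - 1)) + 2 * 0 + 1"
  then show ?thesis using assms by (simp add: label_shared)
next
  assume 1: "label m r s 0 j k \<le> m * (block_rank s 0 (r + s) + s)"
    and 2: "odd (r + s) \<Longrightarrow> odd s \<Longrightarrow> label m r s 0 j k \<le> m * (block_rank s 0 (r + s) + (s - 1))"
  have "m * (block_rank s 0 (r + s) + s) = m * (block_rank s 0 (r + s) + (s - 1)) + m"
    using assms(1) by (cases s) auto
  then show ?thesis using 1 2 unfolding label_shared[OF assms(4)] by auto
qed

text \<open>
  The unpaired type and the edges in its gaps are told apart by the parity of their places;
  beyond the gaps a comparison of sizes suffices.
\<close>
lemma label_private_neq_shared: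
  assumes "j < s" "j < k" "k \<le> r + s" "s \<le> j'" "i < m"
  shows "label m r s i j k \<noteq> label m r s i' j' k'"
proof (rule label_private_cases[OF assms(1-3,5)])
  assume *: "odd (r + s)" "odd s" "label m r s i j k = m * (block_rank s 0 (r + s) + (s - 1)) + 2 * i + 1"
  let ?t = "shared_rank s j' k'"
  have "2 * i + 1 \<noteq> ?t + 1 + min (?t + 1) m"
    using assms(5) by (cases "?t + 1 \<le> m"; simp; presburger)
  then show ?thesis using assms * by (simp add: label_shared)
next
  assume 1: "label m r s i j k \<le> m * (block_rank s 0 (r + s) + s)"
    and 2: "odd (r + s) \<Longrightarrow> odd s \<Longrightarrow> label m r s i j k \<le> m * (block_rank s 0 (r + s) + (s - 1))"
  have "m * (block_rank s 0 (r + s) + s) = m * (block_rank s 0 (r + s) + (s - 1)) + m"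
    using assms(1) by (cases s) auto
  then show ?thesis using 1 2 unfolding label_shared[OF assms(4)] by auto
qed

lemma label_plain_less_paired:
  assumes "k < r + s" "j < k" "j < s" "i < m" "j' < s" "odd (r + s)"
  shows "label m r s i j k < label m r s i' j' (r + s)"
proof -
  have *: "\<not> (odd (r + s) \<and> k = r + s)" using assms by simp
  have "block_rank s j k < block_rank s 0 (r + s)" using assms by (intro block_rank_less) auto
  then have "block_rank s j k < block_rank s 0 (r + s) + 2 * (j' div 2)" by simp
  from mult_block_less[OF this offset_less[OF assms(4), of "slope r s j k"]] show ?thesis
    unfolding label_plain[OF assms(3) *] label_paired[OF assms(5,6) refl] by simp
qed

text \<open>
  In the column of slope \<open>2\<close>, dividing by \<open>2 m\<close> recovers the pair of types, and the remainder
  determines the type within the pair and the copy.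
\<close>
lemma label_inj_private:
  assumes "j < s" "j < k" "k \<le> r + s" "i < m" "j' < s" "j' < k'" "k' \<le> r + s" "i' < m"
    and eq: "label m r s i j k = label m r s i' j' k'"
  shows "i = i' \<and> j = j' \<and> k = k'"
proof (cases "odd (r + s) \<and> (k = r + s \<or> k' = r + s)")
  case True
  then have odd: "odd (r + s)" by simp
  have "\<not> k < r + s"
  proof
    assume "k < r + s"
    with True have "k' = r + s" by simp
    with eq label_plain_less_paired[OF \<open>k < r + s\<close> assms(2,1,4,5) odd, of i'] show False by simp
  qed
  moreover have "\<not> k' < r + s"
  proof
    assume "k' < r + s"
    with True have "k = r + s" by simp
    with eq label_plain_less_paired[OF \<open>k' < r + s\<close> assms(6,5,8,1) odd, of i] show False by simp
  qed
  ultimately have last: "odd (r + s)" "k = r + s" "k' = r + s"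
    using odd assms(3,7) by simp_all
  have e: "m * (2 * (j div 2)) + 2 * i + j mod 2 = m * (2 * (j' div 2)) + 2 * i' + j' mod 2"
    using eq label_paired[OF assms(1) last(1,2), of m i] label_paired[OF assms(5) last(1,3), of m i']
    by (simp add: distrib_left)
  have split: "(m * (2 * (j div 2)) + 2 * i + j mod 2) div (2 * m) = j div 2 \<and>
      (m * (2 * (j div 2)) + 2 * i + j mod 2) mod (2 * m) = 2 * i + j mod 2" if "i < m" for i j
  proof -
    have "2 * i + j mod 2 < 2 * m" using that by (cases "even j") auto
    moreover have "m * (2 * (j div 2)) + 2 * i + j mod 2 = (2 * i + j mod 2) + j div 2 * (2 * m)"
      by simp
    moreover have "m \<noteq> 0" using that by simp
    ultimately show ?thesis by (simp only: div_mult_self1 mod_mult_self1) simp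
  qed
  have 1: "j div 2 = j' div 2" and 2: "2 * i + j mod 2 = 2 * i' + j' mod 2"
    using split[OF assms(4), of j] split[OF assms(8), of j'] e by metis+
  have "j mod 2 = j' mod 2" using arg_cong[OF 2, of "\<lambda>x. x mod 2"] by simp
  with 1 2 have "j = j'" "i = i'" by (metis div_mult_mod_eq, simp)
  then show ?thesis using last by simp
next
  case False
  then have plain: "\<not> (odd (r + s) \<and> k = r + s)" "\<not> (odd (r + s) \<and> k' = r + s)" by auto
  let ?c = "offset m (slope r s j k) i" and ?c' = "offset m (slope r s j' k') i'"
  have e: "m * block_rank s j k + ?c = m * block_rank s j' k' + ?c'"
    using eq unfolding label_plain[OF assms(1) plain(1)] label_plain[OF assms(5) plain(2)] by simp
  have "\<not> block_rank s j k < block_rank s j' k'"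
    using mult_block_less[OF _ offset_less[OF assms(4)], of "block_rank s j k" "block_rank s j' k'" "slope r s j k"] e
    by linarith
  moreover have "\<not> block_rank s j' k' < block_rank s j k"
    using mult_block_less[OF _ offset_less[OF assms(8)], of "block_rank s j' k'" "block_rank s j k" "slope r s j' k'"] e
    by linarith
  ultimately have jk: "j = j'" "k = k'"
    unfolding block_rank_less_iff[OF assms(2,1,6,5)] block_rank_less_iff[OF assms(6,5,2,1)] by auto
  with e have "offset m (slope r s j k) i = offset m (slope r s j k) i'" by simp
  with assms(4,8) have "i = i'" by (auto simp: offset_def split: if_splits)
  with jk show ?thesis by simp
qed

lemma card_edge_index:
  "card (edge_index m r s) = m * (\<Sum>l\<le>r + s. min l s) + (\<Sum>l\<le>r + s. l - s)" if "0 < m"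
proof -
  let ?A = "{..<m} \<times> (SIGMA k:{..r + s}. {..<min k s})" and ?B = "SIGMA k:{..r + s}. {s..<k}"
  have "edge_index m r s = (\<lambda>(i, k, j). (i, j, k)) ` ?A \<union> (\<lambda>(k, j). (0, j, k)) ` ?B"
    (is "_ = ?A' \<union> ?B'")
    using that by (auto simp: edge_index_def image_iff)
  moreover have "?A' \<inter> ?B' = {}" by auto
  moreover have "finite ?A'" "finite ?B'" by auto
  ultimately have "card (edge_index m r s) = card ?A' + card ?B'" by (simp add: card_Un_disjoint)
  also have "card ?A' = card ?A" by (intro card_image) (auto simp: inj_on_def)
  also have "card ?B' = card ?B" by (intro card_image) (auto simp: inj_on_def)
  finally show ?thesis by (simp add: card_cartesian_product)
qed

lemma sum_excess: "(\<Sum>l\<le>r + s. l - s) = (r + 1) choose 2"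
proof (induction r)
  case 0
  have "(\<Sum>l\<le>s. l - s) = (\<Sum>l\<le>s. 0)" by (intro sum.cong) auto
  then show ?case by simp
next
  case (Suc r)
  then show ?case by (simp add: numeral_2_eq_2)
qed

text \<open>
  The labels are injective and as many as the edges, so it suffices to bound them. The bound on
  \<open>m\<close> is what keeps the unpaired type in range: without enough edges to fill its gaps, its
  last label would be too large.
\<close>
lemma label_bij:
  assumes "0 < m" "0 < s" "odd (r + s) \<Longrightarrow> odd s \<Longrightarrow> m \<le> ((r + 1) choose 2) + 1"
  shows "bij_betw (\<lambda>(i, j, k). label m r s i j k) (edge_index m r s) {1..card (edge_index m r s)}"
    (is "bij_betw ?l ?P _")
proof -
  have inj: "inj_on ?l ?P"
  proof (rule inj_onI)
    fix x y assume "x \<in> ?P" "y \<in> ?P" "?l x = ?l y"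
    moreover obtain i j k i' j' k' where xy: "x = (i, j, k)" "y = (i', j', k')" by (cases x, cases y)
    ultimately have P: "(i, j, k) \<in> ?P" "(i', j', k') \<in> ?P"
      and eq: "label m r s i j k = label m r s i' j' k'" by simp_all
    consider "j < s" "j' < s" | "j < s" "s \<le> j'" | "s \<le> j" "j' < s" | "s \<le> j" "s \<le> j'" by linarith
    then have "i = i' \<and> j = j' \<and> k = k'"
    proof cases
      case 1
      with P eq show ?thesis by (intro label_inj_private) (simp_all add: edge_index_def)
    next
      case 2
      with P eq label_private_neq_shared[of j s k r j' i m i' k'] show ?thesis
        by (simp add: edge_index_def)
    next
      case 3
      with P eq label_private_neq_shared[of j' s k' r j i' m i k] show ?thesis
        by (simp add: edge_index_def)
    next
      case 4
      with P have lt: "j < k" "j' < k'" "i = 0" "i' = 0" by (simp_all add: edge_index_def)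
      have "\<not> (k < k' \<or> k = k' \<and> j < j')"
        using label_mono_shared[OF 4(1) lt(1) 4(2) lt(2), of m r i i'] eq by auto
      moreover have "\<not> (k' < k \<or> k' = k \<and> j' < j)"
        using label_mono_shared[OF 4(2) lt(2) 4(1) lt(1), of m r i' i] eq by auto
      ultimately show ?thesis using lt by auto
    qed
    then show "x = y" by (simp add: xy)
  qed
  have N: "card ?P = m * (block_rank s 0 (r + s) + s) + ((r + 1) choose 2)"
  proof -
    have "{..r + s} = insert (r + s) {..<r + s}" by auto
    then have "(\<Sum>l\<le>r + s. min l s) = block_rank s 0 (r + s) + s" by (simp add: block_rank_def)
    then show ?thesis by (simp add: card_edge_index[OF assms(1)] sum_excess)
  qed
  have "?l ` ?P \<subseteq> {1..card ?P}"
  proof (rule image_subsetI)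
    fix x assume "x \<in> ?P"
    moreover obtain i j k where x: "x = (i, j, k)" by (cases x)
    ultimately have P: "(i, j, k) \<in> ?P" by simp
    have pos: "1 \<le> label m r s i j k" by (simp add: label_def)
    have m: "m * (block_rank s 0 (r + s) + s) = m * (block_rank s 0 (r + s) + (s - 1)) + m" if "0 < s"
      using that by (cases s) auto
    have le: "label m r s i j k \<le> card ?P"
    proof (cases "s \<le> j")
      case True
      have "j - s < k - s" using P True by (auto simp: edge_index_def)
      then have "shared_rank s j k < (\<Sum>l<Suc k. l - s)"
        by (simp only: shared_rank_def sum.lessThan_Suc add_strict_left_mono)
      also have "\<dots> \<le> (\<Sum>l\<le>r + s. l - s)" using P by (intro sum_mono2) (auto simp: edge_index_def)
      finally have t: "shared_rank s j k < (r + 1) choose 2" by (simp only: sum_excess)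
      show ?thesis using t m[OF \<open>0 < s\<close>] unfolding N label_shared[OF True] by (simp add: min_def)
    next
      case False
      then have "j < s" "j < k" "k \<le> r + s" "i < m" using P by (auto simp: edge_index_def)
      then show ?thesis
      proof (rule label_private_cases)
        assume "odd (r + s)" "odd s" "label m r s i j k = m * (block_rank s 0 (r + s) + (s - 1)) + 2 * i + 1"
        then show ?thesis using assms(3) m[OF \<open>0 < s\<close>] \<open>i < m\<close> unfolding N by simp
      qed (simp add: N)
    qed
    from pos le show "?l x \<in> {1..card ?P}" by (simp add: x)
  qed
  then have "?l ` ?P = {1..card ?P}"
    by (intro card_subset_eq) (simp_all add: card_image[OF inj])
  with inj show ?thesis by (simp add: bij_betw_def)
qed


section \<open>The colours increase with the position\<close>
definition edge_label :: "nat \<Rightarrow> nat \<Rightarrow> nat \<Rightarrow> nat \<Rightarrow> nat \<Rightarrow> nat \<Rightarrow> nat" where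
  "edge_label m r s i j k = label m r s i (min j k) (max j k)"

lemma edge_label_mono_first:
  assumes "0 < m" "j < j'" "j' \<le> r + s" "k \<le> r + s" "k \<noteq> j" "k \<noteq> j'"
  shows "edge_label m r s 0 j k < edge_label m r s 0 j' k"
proof -
  have mm: "min j k < max j k" "min j' k < max j' k" "max j k \<le> r + s" "max j' k \<le> r + s"
      "max j k < max j' k \<or> max j k = max j' k \<and> min j k < min j' k" "min j k \<le> min j' k"
    using assms by (auto simp: min_def max_def)
  consider "min j' k < s" | "min j k < s" "s \<le> min j' k" | "s \<le> min j k" by linarith
  then have "label m r s 0 (min j k) (max j k) < label m r s 0 (min j' k) (max j' k)"
  proof cases
    case 1
    with mm(6) have "min j k < s" by linarith
    then show ?thesis using mm(1,3) 1 mm(2,4) \<open>0 < m\<close> mm(5) by (rule label_mono_private)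
  next
    case 2
    show ?thesis using 2(1) mm(1,3) 2(2) \<open>0 < m\<close> by (rule label_private_less_shared)
  next
    case 3
    show ?thesis using 3 mm by (intro label_mono_shared) auto
  qed
  then show ?thesis by (simp add: edge_label_def)
qed

lemma edge_label_mono_shared:
  assumes "i < m" "j < j'" "j' \<le> r + s" "s \<le> j" "k < s"
  shows "edge_label m r s i j k < edge_label m r s i j' k"
  using assms label_mono_private[of k s j r k j' i m] by (simp add: edge_label_def min_def max_def)

lemma sum_row_mono:
  fixes f :: "nat \<Rightarrow> nat \<Rightarrow> nat"
  assumes "finite A" "j \<in> A" "j' \<in> A" "j \<noteq> j'" "f j j' = f j' j"
    and "\<And>k. k \<in> A - {j, j'} \<Longrightarrow> f j k < f j' k"
  shows "(\<Sum>k\<in>A - {j}. f j k) \<le> (\<Sum>k\<in>A - {j'}. f j' k)"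
    and "A - {j, j'} \<noteq> {} \<Longrightarrow> (\<Sum>k\<in>A - {j}. f j k) < (\<Sum>k\<in>A - {j'}. f j' k)"
proof -
  have "(\<Sum>k\<in>A - {j}. f j k) = f j j' + (\<Sum>k\<in>A - {j} - {j'}. f j k)"
    using assms(1,3,4) by (intro sum.remove) auto
  then have j: "(\<Sum>k\<in>A - {j}. f j k) = f j j' + (\<Sum>k\<in>A - {j, j'}. f j k)"
    by (simp only: Diff_insert2[of A j "{j'}"])
  have "(\<Sum>k\<in>A - {j'}. f j' k) = f j' j + (\<Sum>k\<in>A - {j'} - {j}. f j' k)"
    using assms(1,2,4) by (intro sum.remove) auto
  then have j': "(\<Sum>k\<in>A - {j'}. f j' k) = f j j' + (\<Sum>k\<in>A - {j, j'}. f j' k)"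
    by (simp only: Diff_insert[of A j "{j'}"] assms(5))
  show "(\<Sum>k\<in>A - {j}. f j k) \<le> (\<Sum>k\<in>A - {j'}. f j' k)"
    unfolding j j' by (intro add_left_mono sum_mono less_imp_le assms(6))
  show "(\<Sum>k\<in>A - {j}. f j k) < (\<Sum>k\<in>A - {j'}. f j' k)" if "A - {j, j'} \<noteq> {}"
    unfolding j j' using assms(1) that by (intro add_strict_left_mono sum_strict_mono assms(6)) simp_all
qed

text \<open>
  The sum at a private position is affine in the copy, with the sum of the slopes as its slope.
\<close>
lemma edge_label_row_sum:
  assumes "1 \<le> r" "i < m" "j < s"
  shows "(\<Sum>k\<in>{..r + s} - {j}. edge_label m r s i j k) = (\<Sum>k\<in>{..r + s} - {j}. edge_label m r s 0 j k)"
proof -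
  have "int (edge_label m r s i j k) = int (edge_label m r s 0 j k) + slope r s j k * int i"
    if "k \<in> {..r + s} - {j}" for k
  proof (cases "j < k")
    case True
    then show ?thesis using that assms label_affine[of j s k r i m] by (simp add: edge_label_def min_def max_def)
  next
    case False
    then have "slope r s k j = slope r s j k" using that assms by (simp add: slope_def add.commute)
    then show ?thesis
      using False that assms label_affine[of k s j r i m] by (simp add: edge_label_def min_def max_def)
  qed
  then have "(\<Sum>k\<in>{..r + s} - {j}. int (edge_label m r s i j k)) =
      (\<Sum>k\<in>{..r + s} - {j}. int (edge_label m r s 0 j k) + slope r s j k * int i)"
    by (intro sum.cong refl)
  also have "\<dots> = (\<Sum>k\<in>{..r + s} - {j}. int (edge_label m r s 0 j k))"
    by (simp add: sum.distrib sum_distrib_right[symmetric] sum_slope_eq_0[OF assms(1,3)])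
  finally show ?thesis by (simp flip: of_nat_sum)
qed

text \<open>
  The sums are strictly increasing in the position, hence distinct.
\<close>
lemma chi_la_join_amalg:
  assumes "0 < m" "1 \<le> r" "0 < s"
    and "odd (r + s) \<Longrightarrow> odd s \<Longrightarrow> m \<le> ((r + 1) choose 2) + 1"
  shows "chi_la (join_K1 (amalg_complete m (r + s) r)) = r + s + 1"
proof -
  let ?f = "edge_label m r s"
  have comm: "?f i j k = ?f i k j" for i j k by (simp add: edge_label_def min.commute max.commute)
  define F where "F j = (if j < s then \<Sum>k\<in>{..r + s} - {j}. ?f 0 j k
    else (\<Sum>k\<in>{s..r + s} - {j}. ?f 0 j k) + (\<Sum>k<s. \<Sum>i<m. ?f i j k))" for j
  have less: "F j < F j'" if "j < j'" "j' \<le> r + s" for j j'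
  proof -
    have row: "(\<Sum>k\<in>{..r + s} - {j}. ?f 0 j k) < (\<Sum>k\<in>{..r + s} - {j'}. ?f 0 j' k)"
    proof (rule sum_row_mono(2))
      \<comment> \<open>There are at least three positions, so some term is strictly larger.\<close>
      have "card {..r + s} > card {j, j'}" using assms(2,3) that(1) by simp
      then show "{..r + s} - {j, j'} \<noteq> {}"
        by (metis Diff_eq_empty_iff card_mono finite.emptyI finite.insertI not_less)
      show "?f 0 j j' = ?f 0 j' j" by (rule comm)
      show "?f 0 j k < ?f 0 j' k" if "k \<in> {..r + s} - {j, j'}" for k
        using that \<open>j < j'\<close> \<open>j' \<le> r + s\<close> \<open>0 < m\<close> by (intro edge_label_mono_first) simp_all
    qed (use that in simp_all)
    consider "j' < s" | "j < s" "s \<le> j'" | "s \<le> j" using that by linarith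
    then show ?thesis
    proof cases
      case 1
      with row show ?thesis using that by (simp add: F_def)
    next
      case 2
      have "{..r + s} - {j'} = ({s..r + s} - {j'}) \<union> {..<s}" using 2 by auto
      moreover have "({s..r + s} - {j'}) \<inter> {..<s} = {}" by auto
      ultimately have "(\<Sum>k\<in>{..r + s} - {j'}. ?f 0 j' k) =
          (\<Sum>k\<in>{s..r + s} - {j'}. ?f 0 j' k) + (\<Sum>k<s. ?f 0 j' k)"
        by (simp add: sum.union_disjoint)
      \<comment> \<open>The edges to the other copies only increase the sum at the shared position.\<close>
      also have "\<dots> \<le> F j'"
        using 2 \<open>0 < m\<close> by (auto simp: F_def intro!: sum_mono member_le_sum)
      finally have le: "(\<Sum>k\<in>{..r + s} - {j'}. ?f 0 j' k) \<le> F j'" .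
      with row show ?thesis using 2 by (simp add: F_def)
    next
      case 3
      have "(\<Sum>k\<in>{s..r + s} - {j}. ?f 0 j k) \<le> (\<Sum>k\<in>{s..r + s} - {j'}. ?f 0 j' k)"
      proof (rule sum_row_mono(1))
        show "?f 0 j j' = ?f 0 j' j" by (rule comm)
        show "?f 0 j k < ?f 0 j' k" if "k \<in> {s..r + s} - {j, j'}" for k
          using that \<open>j < j'\<close> \<open>j' \<le> r + s\<close> \<open>0 < m\<close> by (intro edge_label_mono_first) simp_all
      qed (use 3 that in simp_all)
      moreover have "(\<Sum>k<s. \<Sum>i<m. ?f i j k) < (\<Sum>k<s. \<Sum>i<m. ?f i j' k)"
        using 3 that \<open>0 < m\<close> \<open>0 < s\<close> by (intro sum_strict_mono edge_label_mono_shared) auto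
      ultimately show ?thesis using 3 that by (simp add: F_def)
    qed
  qed
  show ?thesis
  proof (rule chi_la_join_amalg_eqI[where f = ?f and F = F])
    show "?f i j k = ?f 0 j k" if "s \<le> j" "s \<le> k" for i j k
      using that by (simp add: edge_label_def label_shared)
    have "label m r s i j k = ?f i j k" if "(i, j, k) \<in> edge_index m r s" for i j k
      using that by (simp add: edge_label_def edge_index_def)
    then show "bij_betw (\<lambda>(i, j, k). ?f i j k) (edge_index m r s) {1..card (edge_index m r s)}"
      using label_bij[OF assms(1,3,4)] by (subst bij_betw_cong[where g = "\<lambda>(i, j, k). label m r s i j k"]) auto
    show "inj_on F {..r + s}"
      using less by (intro linorder_inj_onI') (auto simp: less_imp_neq)
    show "(\<Sum>k\<in>{..r + s} - {j}. ?f i j k) = F j" if "i < m" "j < s" for i j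
      using edge_label_row_sum[OF \<open>1 \<le> r\<close> that] that by (simp add: F_def)
  qed (use \<open>0 < m\<close> comm in \<open>simp_all add: F_def\<close>)
qed

theorem theorem3p2:
  fixes m n r :: nat
  assumes "m \<ge> 2" and "n \<ge> r + 1" and "r + 1 \<ge> 2"
    and "(3 \<le> m \<and> m \<le> 4 \<and> 2 \<le> r \<and> r \<le> 3) \<or> (m - 1) * (r - 1) \<le> (r + 1) choose 2"
  shows "chi_la (join_K1 (amalg_complete m n r)) = n + 1"
proof -
  define s where "s = n - r"
  have s: "n = r + s" "0 < s" using assms(2) by (simp_all add: s_def)
  have "m \<le> ((r + 1) choose 2) + 1" if "odd (r + s)" "odd s"
  proof -
    \<comment> \<open>Here \<open>r\<close> is even, so the factor \<open>r - 1\<close> is at least \<open>1\<close>.\<close>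
    have "2 \<le> r" using that assms(3) by (cases "r = 1") auto
    from assms(4) show ?thesis
    proof
      assume "3 \<le> m \<and> m \<le> 4 \<and> 2 \<le> r \<and> r \<le> 3"
      moreover have "3 choose 2 \<le> (r + 1) choose 2" using \<open>2 \<le> r\<close> by (intro binomial_right_mono) simp
      moreover have "(3 :: nat) choose 2 = 3" by (simp add: choose_two)
      ultimately show ?thesis by linarith
    next
      assume "(m - 1) * (r - 1) \<le> (r + 1) choose 2"
      moreover have "(m - 1) * 1 \<le> (m - 1) * (r - 1)" using \<open>2 \<le> r\<close> by (intro mult_le_mono2) simp
      ultimately show ?thesis by linarith
    qed
  qed
  then show ?thesis using chi_la_join_amalg[of m r s] assms(1,3) s by simp
qed

end
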